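(* Let $\lambda$ be a nonzero real number. Define the degenerate B-algorithm matrix $(a_{n,m}(\lambda))_{n,m\ge0}$ by $a_{0,m}(\lambda)=\frac{\binom{m-\lambda}{m}}{m+1}$ for $m\ge0$ and \[ a_{n,m}(\lambda)=\big(m-(n-1)\lambda\big)a_{n-1,m}(\lambda)-(m+1)a_{n-1,m+1}(\lambda),\qquad n\ge1,\ m\ge0. \] Then for every $n\ge0$, \[ a_{n,0}(\lambda)=\sum_{k=0}^{n}(-1)^{k}k!\,{n \brace k}_{\lambda}\frac{\binom{k-\lambda}{k}}{k+1}=\beta_{n,\lambda}, \] and \[ \sum_{k=0}^{n}S_{1,\lambda}(n,k)\,\beta_{k,\lambda}=(-1)^{n}\frac{(n-\lambda)_{n}}{n+1}. \]
   Context: For $n\ge0$ set $(x)_{0,\lambda}=1$, $(x)_{n,\lambda}=x(x-\lambda)\cdots(x-(n-1)\lambda)$ for $n\ge1$, and $(x)_0=1$, $(x)_n=x(x-1)\cdots(x-n+1)$ for $n\ge1$; $\binom{k-\lambda}{k}=(k-\lambda)_k/k!$. The degenerate exponential is $e_\lambda(t)=\sum_{k\ge0}(1)_{k,\lambda}\frac{t^k}{k!}$ (i.e. $(1+\lambda t)^{1/\lambda}$), and $\log_\lambda$ is its compositional inverse, so $\log_\lambda(1+t)=\sum_{n\ge1}\frac{(-1)^{n-1}}{n}\binom{n-1-\lambda}{n-1}t^n$. The degenerate Stirling numbers of the second kind ${n \brace k}_{\lambda}$ are defined by $(x)_{n,\lambda}=\sum_{k=0}^{n}{n \brace k}_{\lambda}(x)_{k}$;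 the degenerate Stirling numbers of the first kind $S_{1,\lambda}(n,k)$ are defined by $\frac{1}{k!}(\log_\lambda(1+t))^k=\sum_{n\ge k}S_{1,\lambda}(n,k)\frac{t^n}{n!}$ (with $S_{1,\lambda}(n,k)=0$ for $n<k$). The degenerate Bernoulli numbers are defined by $\frac{t}{e_\lambda(t)-1}=\sum_{n\ge0}\beta_{n,\lambda}\frac{t^n}{n!}$. *)

theory Defs
  imports Complex_Main "HOL-Computational_Algebra.Formal_Power_Series"
begin

definition deg_falling :: "real \<Rightarrow> real \<Rightarrow> nat \<Rightarrow> real" where
  "deg_falling lam x n = (\<Prod>i<n. x - real i * lam)"

definition falling :: "real \<Rightarrow> nat \<Rightarrow> real" where
  "falling x n = (\<Prod>i<n. x - real i)"

lemma gbinomial_falling: "x gchoose k = falling x k / fact k"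
  by (simp add: gbinomial_prod_rev falling_def atLeast0LessThan)

definition deg_exp :: "real \<Rightarrow> real fps" where
  "deg_exp lam = Abs_fps (\<lambda>k. deg_falling lam 1 k / fact k)"

text \<open>
  The series of \<open>log\<^sub>\<lambda>(1 + t)\<close> in \<open>t\<close>: as \<open>log\<^sub>\<lambda>\<close> inverts \<open>e\<^sub>\<lambda>\<close>, this is the compositional
  inverse of \<open>e\<^sub>\<lambda>(t) - 1\<close>, which has zero constant term and linear coefficient 1.
\<close>

definition deg_log1p :: "real \<Rightarrow> real fps" where
  "deg_log1p lam = fps_inv (deg_exp lam - 1)"

lemma deg_exp_nth_0: "fps_nth (deg_exp lam) 0 = 1"
  and deg_exp_nth_1: "fps_nth (deg_exp lam) 1 = 1"
  by (simp_all add: deg_exp_def deg_falling_def)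

lemma deg_log1p_compose:
  "deg_log1p lam oo (deg_exp lam - 1) = fps_X"
  "(deg_exp lam - 1) oo deg_log1p lam = fps_X"
  unfolding deg_log1p_def
  by (rule fps_inv fps_inv_right; simp add: deg_exp_nth_0 deg_exp_nth_1[simplified])+

text \<open>
  Row \<open>n\<close> of the second-kind numbers is the unique coefficient sequence, zero beyond \<open>n\<close>, that
  expands \<open>(x)\<^bsub>n,\<lambda>\<^esub>\<close> in the falling factorials.
\<close>

definition deg_stirling2 :: "real \<Rightarrow> nat \<Rightarrow> nat \<Rightarrow> real" where
  "deg_stirling2 lam n =
     (THE c. (\<forall>x. deg_falling lam x n = (\<Sum>k\<le>n. c k * falling x k)) \<and> (\<forall>k>n. c k = 0))"

lemma falling_sum_eq_0:
  assumes "\<And>x. (\<Sum>k\<le>n. d k * falling x k) = 0" and "j \<le> n"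
  shows "d j = 0"
  using assms(2)
proof (induction j rule: less_induct)
  case (less j)
  have "d k * falling (real j) k = 0" if "k \<noteq> j" "k \<le> n" for k
  proof (cases "k < j")
    case True
    with less that show ?thesis by simp
  next
    case False
    with that have "j \<in> {..<k}" by simp
    then show ?thesis unfolding falling_def by (intro mult_eq_0_iff[THEN iffD2] disjI2 prod_zero) auto
  qed
  then have "(\<Sum>k\<le>n. d k * falling (real j) k) = (\<Sum>k\<in>{j}. d k * falling (real j) k)"
    using less.prems by (intro sum.mono_neutral_right) auto
  then have "d j * falling (real j) j = 0" using assms(1)[of "real j"] by simp
  moreover have "falling (real j) j \<noteq> 0" by (auto simp: falling_def)
  ultimately show ?case by simp
qed

lemma deg_falling_expansion_exists:
  "\<exists>c. (\<forall>x. deg_falling lam x n = (\<Sum>k\<le>n. c k * falling x k)) \<and> (\<forall>k>n. c k = (0::real))"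
proof (induction n)
  case 0
  show ?case by (rule exI[of _ "\<lambda>k. if k = 0 then 1 else 0"]) (simp add: deg_falling_def falling_def)
next
  case (Suc n)
  then obtain c where c: "\<And>x. deg_falling lam x n = (\<Sum>k\<le>n. c k * falling x k)"
    and c0: "\<And>k. k > n \<Longrightarrow> c k = (0::real)" by auto
  define c' where "c' k = (case k of 0 \<Rightarrow> 0 | Suc j \<Rightarrow> c j) + (real k - real n * lam) * c k" for k
  have "deg_falling lam x (Suc n) = (\<Sum>k\<le>Suc n. c' k * falling x k)" for x
  proof -
    have "deg_falling lam x (Suc n) = (\<Sum>k\<le>n. c k * falling x k) * (x - real n * lam)"
      using c[of x] by (simp add: deg_falling_def)
    also have "\<dots> = (\<Sum>k\<le>n. c k * falling x (Suc k) + (real k - real n * lam) * c k * falling x k)"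
      unfolding sum_distrib_right by (intro sum.cong refl) (simp add: falling_def algebra_simps)
    also have "\<dots> = (\<Sum>k\<le>n. c k * falling x (Suc k))
        + (\<Sum>k\<le>Suc n. (real k - real n * lam) * c k * falling x k)"
      by (simp add: sum.distrib c0)
    also have "(\<Sum>k\<le>n. c k * falling x (Suc k))
        = (\<Sum>k\<le>Suc n. (case k of 0 \<Rightarrow> 0 | Suc j \<Rightarrow> c j) * falling x k)"
      by (subst sum.atMost_Suc_shift) simp
    finally show ?thesis by (simp only: c'_def distrib_right sum.distrib)
  qed
  moreover have "c' k = 0" if "k > Suc n" for k
    using that by (auto simp: c'_def c0 split: nat.split)
  ultimately show ?case by blast
qed

lemma deg_stirling2:
  shows deg_falling_eq_deg_stirling2:
      "deg_falling lam x n = (\<Sum>k\<le>n. deg_stirling2 lam n k * falling x k)"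
    and deg_stirling2_eq_0: "k > n \<Longrightarrow> deg_stirling2 lam n k = 0"
proof -
  let ?P = "\<lambda>c. (\<forall>x. deg_falling lam x n = (\<Sum>k\<le>n. c k * falling x k)) \<and> (\<forall>k>n. c k = 0)"
  have "\<exists>!c. ?P c"
  proof (rule ex_ex1I)
    show "\<exists>c. ?P c" by (rule deg_falling_expansion_exists)
  next
    fix c d assume cd: "?P c" "?P d"
    have *: "(\<Sum>k\<le>n. (c k - d k) * falling x k) = 0" for x
      using cd by (simp add: left_diff_distrib sum_subtractf)
    show "c = d"
    proof
      fix j show "c j = d j"
        using falling_sum_eq_0[OF *, of j] cd by (cases "j \<le> n") auto
    qed
  qed
  from theI'[OF this]
  show "deg_falling lam x n = (\<Sum>k\<le>n. deg_stirling2 lam n k * falling x k)"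
    and "k > n \<Longrightarrow> deg_stirling2 lam n k = 0"
    unfolding deg_stirling2_def by blast+
qed

definition deg_stirling1 :: "real \<Rightarrow> nat \<Rightarrow> nat \<Rightarrow> real" where
  "deg_stirling1 lam n k = fact n * fps_nth (fps_const (1 / fact k) * deg_log1p lam ^ k) n"

lemma deg_stirling1_eq_0: "n < k \<Longrightarrow> deg_stirling1 lam n k = 0"
  by (simp add: deg_stirling1_def deg_log1p_def fps_inv_def startsby_zero_power_prefix)

text \<open>
  The quotient is that of formal power series; numerator and denominator both have subdegree 1.
\<close>

definition deg_bernoulli :: "real \<Rightarrow> nat \<Rightarrow> real" where
  "deg_bernoulli lam n = fact n * fps_nth (fps_X / (deg_exp lam - 1)) n"

lemma deg_bernoulli_quotient: "fps_X / (deg_exp lam - 1) * (deg_exp lam - 1) = fps_X"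
proof -
  have nz: "fps_nth (deg_exp lam - 1) 1 \<noteq> 0" by (simp add: deg_exp_nth_1[simplified])
  then have "deg_exp lam - 1 \<noteq> 0" by (metis fps_zero_nth)
  moreover have "subdegree (deg_exp lam - 1) = 1"
    using nz by (intro subdegreeI) (auto simp: deg_exp_nth_0)
  ultimately have "(deg_exp lam - 1) dvd fps_X"
    by (subst fps_dvd_iff) auto
  then show ?thesis by simp
qed

primrec deg_B_matrix :: "real \<Rightarrow> nat \<Rightarrow> nat \<Rightarrow> real" where
  "deg_B_matrix lam 0 m = ((real m - lam) gchoose m) / (real m + 1)"
| "deg_B_matrix lam (Suc n) m =
     (real m - real n * lam) * deg_B_matrix lam n m
     - (real m + 1) * deg_B_matrix lam n (m + 1)"

end

theory Submission
  imports Defs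
begin

text \<open>
  With \<open>G\<^sub>n(x) = \<Sum>\<^sub>m a\<^bsub>n,m\<^esub> x\<^sup>m\<close> the matrix recursion reads \<open>G\<^sub>n\<^sub>+\<^sub>1 = ((x - 1) D - n \<lambda>) G\<^sub>n\<close>. Hence
  \<open>G\<^sub>n = ((x - 1) D)\<^bsub>n,\<lambda>\<^esub> G\<^sub>0\<close>, which equals the Stirling combination of the operators
  \<open>((x - 1) D)\<^sub>k = (x - 1)\<^sup>k D\<^sup>k\<close>; evaluating at \<open>x = 0\<close> gives the first equality. Writing
  \<open>log\<^sub>\<lambda>(1 + t) = t F(t)\<close>, where \<open>F\<close> has the coefficients \<open>(-1)\<^sup>n a\<^bsub>0,n\<^esub>\<close>, one has
  \<open>t / (e\<^sub>\<lambda>(t) - 1) = F(e\<^sub>\<lambda>(t) - 1)\<close>. Expanding the right-hand side in powers of \<open>e\<^sub>\<lambda>(t) - 1\<close>, the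
  generating functions of the second-kind numbers, gives the second equality; substituting
  \<open>t = log\<^sub>\<lambda>(1 + u)\<close> gives the third.
\<close>

section \<open>Recurrence of the second-kind numbers\<close>

lemma deg_stirling2_0: "deg_stirling2 lam 0 k = (if k = 0 then 1 else 0)"
  using deg_falling_eq_deg_stirling2[of lam 0 0] deg_stirling2_eq_0[of 0 k lam]
  by (auto simp: deg_falling_def falling_def)

text \<open>Splitting \<open>x - n*lam\<close> as \<open>(x - k) + (k - n*lam)\<close> turns each
  \<open>falling x k\<close> into the next one plus a multiple of itself; linear independence
  (\<open>falling_sum_eq_0\<close>) then identifies the coefficients.\<close>

lemma deg_stirling2_Suc:
  "deg_stirling2 lam (Suc n) k =
     (case k of 0 \<Rightarrow> 0 | Suc j \<Rightarrow> deg_stirling2 lam n j) + (real k - real n * lam) * deg_stirling2 lam n k"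
  (is "_ = ?c k")
proof (cases "k \<le> Suc n")
  case True
  let ?S = "deg_stirling2 lam n"
  have "deg_falling lam x (Suc n) = (\<Sum>k\<le>Suc n. ?c k * falling x k)" for x
  proof -
    have "deg_falling lam x (Suc n) = (\<Sum>k\<le>n. ?S k * falling x k) * (x - real n * lam)"
      by (simp add: deg_falling_eq_deg_stirling2[symmetric]) (simp add: deg_falling_def)
    also have "\<dots> = (\<Sum>k\<le>n. ?S k * falling x (Suc k) + (real k - real n * lam) * ?S k * falling x k)"
      unfolding sum_distrib_right by (intro sum.cong refl) (simp add: falling_def algebra_simps)
    also have "\<dots> = (\<Sum>k\<le>n. ?S k * falling x (Suc k))
        + (\<Sum>k\<le>Suc n. (real k - real n * lam) * ?S k * falling x k)"
      by (simp add: sum.distrib deg_stirling2_eq_0)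
    also have "(\<Sum>k\<le>n. ?S k * falling x (Suc k))
        = (\<Sum>k\<le>Suc n. (case k of 0 \<Rightarrow> 0 | Suc j \<Rightarrow> ?S j) * falling x k)"
      by (subst sum.atMost_Suc_shift) simp
    finally show ?thesis by (simp only: distrib_right sum.distrib)
  qed
  then have "(\<Sum>k\<le>Suc n. (deg_stirling2 lam (Suc n) k - ?c k) * falling x k) = 0" for x
    by (simp only: left_diff_distrib sum_subtractf deg_falling_eq_deg_stirling2[symmetric])
  from falling_sum_eq_0[OF this True] show ?thesis by simp
next
  case False
  then show ?thesis by (auto simp: deg_stirling2_eq_0 split: nat.split)
qed

text \<open>Leaving \<open>g\<close> arbitrary lets the recurrence act on operators: below,
  \<open>g k\<close> is \<open>(x - 1)^k D^k\<close> applied to row 0.\<close>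

lemma sum_deg_stirling2_Suc:
  "(\<Sum>k\<le>Suc n. fps_const (deg_stirling2 lam (Suc n) k) * g k) =
   (\<Sum>k\<le>n. fps_const (deg_stirling2 lam n k) * (g (Suc k) + fps_const (real k - real n * lam) * g k))"
proof -
  let ?S = "\<lambda>k. fps_const (deg_stirling2 lam n k)"
  have "fps_const (deg_stirling2 lam (Suc n) k) =
      fps_const (case k of 0 \<Rightarrow> 0 | Suc j \<Rightarrow> deg_stirling2 lam n j)
      + ?S k * fps_const (real k - real n * lam)" for k
    by (simp add: deg_stirling2_Suc mult.commute)
  then have "(\<Sum>k\<le>Suc n. fps_const (deg_stirling2 lam (Suc n) k) * g k) =
      (\<Sum>k\<le>Suc n. fps_const (case k of 0 \<Rightarrow> 0 | Suc j \<Rightarrow> deg_stirling2 lam n j) * g k)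
      + (\<Sum>k\<le>Suc n. ?S k * (fps_const (real k - real n * lam) * g k))"
    by (simp only: sum.distrib distrib_right mult.assoc)
  also have "(\<Sum>k\<le>Suc n. fps_const (case k of 0 \<Rightarrow> 0 | Suc j \<Rightarrow> deg_stirling2 lam n j) * g k)
      = (\<Sum>k\<le>n. ?S k * g (Suc k))"
    by (subst sum.atMost_Suc_shift) simp
  also have "(\<Sum>k\<le>Suc n. ?S k * (fps_const (real k - real n * lam) * g k))
      = (\<Sum>k\<le>n. ?S k * (fps_const (real k - real n * lam) * g k))"
    by (simp add: deg_stirling2_eq_0)
  finally show ?thesis by (simp add: sum.distrib[symmetric] distrib_left)
qed

section \<open>Generating functions of the matrix rows\<close>

lemma Abs_fps_deg_B_matrix_Suc:
  "Abs_fps (deg_B_matrix lam (Suc n)) =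
     (fps_X - 1) * fps_deriv (Abs_fps (deg_B_matrix lam n))
     - fps_const (real n * lam) * Abs_fps (deg_B_matrix lam n)"
proof (rule fps_ext)
  fix m
  show "fps_nth (Abs_fps (deg_B_matrix lam (Suc n))) m =
    fps_nth ((fps_X - 1) * fps_deriv (Abs_fps (deg_B_matrix lam n))
     - fps_const (real n * lam) * Abs_fps (deg_B_matrix lam n)) m"
    by (cases m) (simp_all add: algebra_simps)
qed

text \<open>The product rule; it is the analogue of \<open>x (x)_k = (x)_(k+1) + k (x)_k\<close> for
  the operator \<open>(x - 1) D\<close> in place of \<open>x\<close>.\<close>

lemma Euler_operator_power:
  fixes G :: "real fps"
  shows "(fps_X - 1) * fps_deriv ((fps_X - 1) ^ k * (fps_deriv ^^ k) G) =
    (fps_X - 1) ^ Suc k * (fps_deriv ^^ Suc k) G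
    + fps_const (real k) * ((fps_X - 1) ^ k * (fps_deriv ^^ k) G)"
proof -
  have "fps_deriv ((fps_X - 1 :: real fps) ^ k) * (fps_X - 1) = fps_const (real k) * (fps_X - 1) ^ k"
  proof (cases k)
    case (Suc j)
    have "fps_deriv ((fps_X - 1 :: real fps) ^ Suc j) = fps_const (real (Suc j)) * (fps_X - 1) ^ j"
      by (simp only: fps_deriv_power) simp
    then show ?thesis by (simp only: Suc power_Suc2 mult.assoc)
  qed simp
  then have "fps_deriv ((fps_X - 1) ^ k) * (fps_X - 1) * (fps_deriv ^^ k) G
      = fps_const (real k) * (fps_X - 1) ^ k * (fps_deriv ^^ k) G"
    by simp
  then show ?thesis by (simp add: algebra_simps)
qed

lemma Abs_fps_deg_B_matrix:
  "Abs_fps (deg_B_matrix lam n) =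
    (\<Sum>k\<le>n. fps_const (deg_stirling2 lam n k)
        * ((fps_X - 1) ^ k * (fps_deriv ^^ k) (Abs_fps (deg_B_matrix lam 0))))"
proof (induction n)
  case 0
  show ?case by (simp add: deg_stirling2_0)
next
  case (Suc n)
  define H where "H k = (fps_X - 1) ^ k * (fps_deriv ^^ k) (Abs_fps (deg_B_matrix lam 0))" for k
  note IH = Suc.IH[folded H_def]
  have H: "(fps_X - 1) * fps_deriv (H k) = H (Suc k) + fps_const (real k) * H k" for k
    unfolding H_def by (rule Euler_operator_power)
  let ?S = "\<lambda>k. fps_const (deg_stirling2 lam n k)"
  have "Abs_fps (deg_B_matrix lam (Suc n)) =
      (\<Sum>k\<le>n. ?S k * ((fps_X - 1) * fps_deriv (H k) - fps_const (real n * lam) * H k))"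
    unfolding Abs_fps_deg_B_matrix_Suc IH
    unfolding fps_deriv_sum sum_distrib_left sum_subtractf[symmetric]
    by (intro sum.cong refl) (simp add: algebra_simps del: fps_const_mult)
  also have "\<dots> = (\<Sum>k\<le>n. ?S k * (H (Suc k) + fps_const (real k - real n * lam) * H k))"
    unfolding H by (intro sum.cong refl) (simp add: fps_const_sub[symmetric] algebra_simps
        del: fps_const_sub fps_const_mult)
  also have "\<dots> = (\<Sum>k\<le>Suc n. fps_const (deg_stirling2 lam (Suc n) k) * H k)"
    by (rule sum_deg_stirling2_Suc[symmetric])
  finally show ?case unfolding H_def .
qed

text \<open>In the constant term, \<open>(x - 1)^k\<close> contributes \<open>(-1)^k\<close> and the
  \<open>k\<close>-th derivative of row 0 contributes \<open>k!\<close> times its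
  \<open>k\<close>-th entry.\<close>

lemma deg_B_matrix_0:
  "deg_B_matrix lam n 0 =
    (\<Sum>k\<le>n. (-1) ^ k * fact k * deg_stirling2 lam n k * deg_B_matrix lam 0 k)"
proof -
  have "deg_B_matrix lam n 0 = fps_nth (Abs_fps (deg_B_matrix lam n)) 0" by simp
  also have "\<dots> = (\<Sum>k\<le>n. (-1) ^ k * fact k * deg_stirling2 lam n k * deg_B_matrix lam 0 k)"
    unfolding Abs_fps_deg_B_matrix[of lam n] fps_sum_nth
    by (intro sum.cong refl) (simp add: fps_nth_power_0 fps_0th_higher_deriv)
  finally show ?thesis .
qed

section \<open>The degenerate exponential and the second-kind numbers\<close>

lemma deg_exp_ODE: "(1 + fps_const lam * fps_X) * fps_deriv (deg_exp lam) = deg_exp lam"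
proof (rule fps_ext)
  fix n
  have step: "fps_nth (deg_exp lam) (Suc n) * (1 + real n) = (1 - real n * lam) * fps_nth (deg_exp lam) n" for n
  proof -
    have "fact (Suc n) = fact n * (1 + real n)" "1 + real n \<noteq> 0" by simp_all
    then show ?thesis
      by (simp add: deg_exp_def deg_falling_def del: fact_Suc)
  qed
  show "fps_nth ((1 + fps_const lam * fps_X) * fps_deriv (deg_exp lam)) n = fps_nth (deg_exp lam) n"
  proof (cases n)
    case 0
    then show ?thesis by (simp add: deg_exp_nth_0 deg_exp_nth_1[simplified] distrib_right mult.assoc)
  next
    case (Suc m)
    then show ?thesis
      using step[of n] by (simp add: distrib_right mult.assoc algebra_simps)
  qed
qed

text \<open>By \<open>deg_exp_ODE\<close>, applying \<open>(1 + lam t) d/dt\<close> to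
  \<open>E^k\<close> gives \<open>k (E^(k-1) + E^k)\<close>; comparing coefficients reproduces
  \<open>deg_stirling2_Suc\<close>.\<close>

lemma deg_exp_minus_1_power_nth:
  "fact n * fps_nth ((deg_exp lam - 1) ^ k) n = fact k * deg_stirling2 lam n k"
proof (induction n arbitrary: k)
  case 0
  show ?case by (simp add: deg_stirling2_0 fps_nth_power_0 deg_exp_nth_0)
next
  case (Suc n)
  let ?E = "deg_exp lam - 1"
  show ?case
  proof (cases k)
    case 0
    \<comment> \<open>The recurrence leaves only \<open>-n*lam\<close> times entry
      \<open>(n, 0)\<close>: the factor vanishes for \<open>n = 0\<close>, the entry for
      \<open>n > 0\<close>.\<close>
    then show ?thesis using Suc.IH[of 0] by (cases "n = 0") (simp_all add: deg_stirling2_Suc)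
  next
    case (Suc j)
    have D: "fps_deriv (?E ^ k) = fps_const (real k) * fps_deriv (deg_exp lam) * ?E ^ j"
      by (simp only: fps_deriv_power Suc) simp
    have "(1 + fps_const lam * fps_X) * fps_deriv (?E ^ k)
        = fps_const (real k) * ((1 + fps_const lam * fps_X) * fps_deriv (deg_exp lam)) * ?E ^ j"
      using D by (simp add: mult_ac)
    \<comment> \<open>Here \<open>deg_exp lam\<close> is read as \<open>1 + ?E\<close>.\<close>
    also have "\<dots> = fps_const (real k) * (?E ^ j + ?E ^ k)"
      unfolding deg_exp_ODE by (simp add: Suc algebra_simps)
    finally have "fps_nth ((1 + fps_const lam * fps_X) * fps_deriv (?E ^ k)) n
        = real k * (fps_nth (?E ^ j) n + fps_nth (?E ^ k) n)"
      by simp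
    moreover have "fps_nth ((1 + fps_const lam * fps_X) * fps_deriv (?E ^ k)) n
        = real (Suc n) * fps_nth (?E ^ k) (Suc n) + lam * real n * fps_nth (?E ^ k) n"
      by (cases n) (simp_all add: distrib_right mult.assoc)
    ultimately have "real (Suc n) * fps_nth (?E ^ k) (Suc n)
        = real k * fps_nth (?E ^ j) n + (real k - real n * lam) * fps_nth (?E ^ k) n"
      by (simp add: algebra_simps)
    from arg_cong[OF this, of "\<lambda>x. fact n * x"]
    have "fact (Suc n) * fps_nth (?E ^ k) (Suc n)
        = real k * (fact n * fps_nth (?E ^ j) n)
          + (real k - real n * lam) * (fact n * fps_nth (?E ^ k) n)"
      by (simp add: algebra_simps)
    then show ?thesis
      unfolding Suc.IH by (simp add: deg_stirling2_Suc Suc algebra_simps)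
  qed
qed

section \<open>Explicit coefficients of the degenerate logarithm\<close>

lemma deg_log1p_nth_0: "fps_nth (deg_log1p lam) 0 = 0"
  by (simp add: deg_log1p_def fps_inv_def)

text \<open>Substituting the logarithm into \<open>deg_exp_ODE\<close> leaves the factor
  \<open>fps_deriv ?e oo ?L\<close>, which the chain rule shows to be the reciprocal of
  \<open>fps_deriv ?L\<close>.\<close>

lemma deg_log1p_ODE: "(1 + fps_X) * fps_deriv (deg_log1p lam) = 1 + fps_const lam * deg_log1p lam"
proof -
  let ?L = "deg_log1p lam" and ?e = "deg_exp lam"
  note L0 = deg_log1p_nth_0[of lam]
  have e: "?e oo ?L = 1 + fps_X"
    using deg_log1p_compose(2)[of lam] by (simp add: fps_compose_sub_distrib algebra_simps)
  have "(1 + fps_const lam * ?L) * (fps_deriv ?e oo ?L)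
      = ((1 + fps_const lam * fps_X) * fps_deriv ?e) oo ?L"
    by (simp add: fps_compose_mult_distrib[OF L0] fps_compose_add_distrib L0)
  also have "\<dots> = 1 + fps_X" by (simp add: deg_exp_ODE e)
  finally have 1: "(1 + fps_const lam * ?L) * (fps_deriv ?e oo ?L) = 1 + fps_X" .
  have "(fps_deriv ?e oo ?L) * fps_deriv ?L = fps_deriv (?e oo ?L)"
    by (rule fps_compose_deriv[OF L0, symmetric])
  also have "\<dots> = 1" by (simp add: e)
  finally have "(fps_deriv ?e oo ?L) * fps_deriv ?L = 1" .
  then show ?thesis by (metis 1 mult.assoc mult.right_neutral)
qed

text \<open>The differential equation is a first-order recursion on the coefficients, with factor
  \<open>-(n + 1 - lam) / (n + 2)\<close>.\<close>

lemma deg_log1p_nth_Suc: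
  "fps_nth (deg_log1p lam) (Suc n) = (-1) ^ n * (falling (real n - lam) n / (fact n * (real n + 1)))"
proof (induction n)
  case 0
  show ?case using arg_cong[OF deg_log1p_ODE[of lam], of "\<lambda>f. fps_nth f 0"]
    by (simp add: deg_log1p_nth_0 falling_def)
next
  case (Suc n)
  have "fps_nth ((1 + fps_X) * fps_deriv (deg_log1p lam)) (Suc n)
      = fps_nth (1 + fps_const lam * deg_log1p lam) (Suc n)"
    by (simp only: deg_log1p_ODE)
  then have "(real n + 2) * fps_nth (deg_log1p lam) (Suc (Suc n))
      = - ((real (Suc n) - lam) * fps_nth (deg_log1p lam) (Suc n))"
    by (simp add: distrib_right algebra_simps)
  then have "fps_nth (deg_log1p lam) (Suc (Suc n))
      = - ((real (Suc n) - lam) * fps_nth (deg_log1p lam) (Suc n)) / (real n + 2)"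
    by (simp add: field_simps)
  \<comment> \<open>Once the first factor is split off, shifting the index by one cancels the one
    added to the argument.\<close>
  moreover have "falling (real (Suc n) - lam) (Suc n) = (real (Suc n) - lam) * falling (real n - lam) n"
    unfolding falling_def by (subst prod.lessThan_Suc_shift) (simp add: algebra_simps)
  ultimately have "fps_nth (deg_log1p lam) (Suc (Suc n))
      = (-1) ^ Suc n * falling (real (Suc n) - lam) (Suc n) / ((real n + 2) * (fact n * (real n + 1)))"
    unfolding Suc.IH by (simp add: mult_ac)
  moreover have "(real n + 2) * (fact n * (real n + 1)) = fact (Suc n) * (real (Suc n) + 1)"
    by (simp add: algebra_simps)
  ultimately show ?case by (simp only: times_divide_eq_right)
qed

section \<open>Bernoulli numbers through composition\<close>

lemma X_div_deg_exp_minus_1: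
  "fps_X / (deg_exp lam - 1) = fps_shift 1 (deg_log1p lam) oo (deg_exp lam - 1)"
proof -
  let ?E = "deg_exp lam - 1" and ?F = "fps_shift 1 (deg_log1p lam)"
  have E0: "fps_nth ?E 0 = 0" by (simp add: deg_exp_nth_0)
  have "fps_nth ?E 1 = 1" by (simp add: deg_exp_nth_1[simplified])
  then have nz: "?E \<noteq> 0" by (metis fps_zero_nth zero_neq_one)
  have L: "deg_log1p lam = ?F * fps_X"
    by (rule fps_ext) (simp add: deg_log1p_nth_0)
  have "(?F oo ?E) * ?E = (?F * fps_X) oo ?E"
    by (simp add: fps_compose_mult_distrib[OF E0] fps_X_fps_compose_startby0[OF E0])
  also have "\<dots> = fps_X" using deg_log1p_compose(1)[of lam] L by simp
  finally have "(?F oo ?E) * ?E = fps_X / ?E * ?E" by (simp add: deg_bernoulli_quotient)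
  with nz show ?thesis by simp
qed

lemma deg_bernoulli_eq_sum_deg_stirling2:
  "deg_bernoulli lam n =
    (\<Sum>k=0..n. (-1) ^ k * fact k * deg_stirling2 lam n k * deg_B_matrix lam 0 k)"
proof -
  have "deg_bernoulli lam n = (\<Sum>k=0..n. fps_nth (deg_log1p lam) (Suc k)
      * (fact n * fps_nth ((deg_exp lam - 1) ^ k) n))"
    by (simp add: deg_bernoulli_def X_div_deg_exp_minus_1 fps_compose_nth sum_distrib_left mult_ac)
  then show ?thesis
    by (simp add: deg_exp_minus_1_power_nth deg_log1p_nth_Suc gbinomial_falling mult_ac)
qed

lemma sum_deg_stirling1_deg_bernoulli:
  "(\<Sum>k=0..n. deg_stirling1 lam n k * deg_bernoulli lam k)
    = (-1) ^ n * (falling (real n - lam) n / (real n + 1))"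
proof -
  let ?L = "deg_log1p lam" and ?E = "deg_exp lam - 1"
  \<comment> \<open>The \<open>1/k!\<close> in \<open>deg_stirling1\<close> cancels the
    \<open>k!\<close> in \<open>deg_bernoulli\<close>, leaving the coefficient formula for a
    composition.\<close>
  have "(\<Sum>k=0..n. deg_stirling1 lam n k * deg_bernoulli lam k)
      = fact n * fps_nth ((fps_X / ?E) oo ?L) n"
    by (simp add: deg_stirling1_def deg_bernoulli_def fps_compose_nth sum_distrib_left mult_ac)
  also have "(fps_X / ?E) oo ?L = fps_shift 1 ?L oo (?E oo ?L)"
    unfolding X_div_deg_exp_minus_1
    by (rule fps_compose_assoc[symmetric]) (simp_all add: deg_log1p_nth_0 deg_exp_nth_0)
  also have "\<dots> = fps_shift 1 ?L" by (simp add: deg_log1p_compose)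
  finally show ?thesis by (simp add: deg_log1p_nth_Suc)
qed

theorem theorem2p5:
  fixes lam :: real
  assumes "lam \<noteq> 0"
  shows "\<forall>n::nat.
      deg_B_matrix lam n 0
        = (\<Sum>k=0..n. (-1) ^ k * fact k * deg_stirling2 lam n k
              * (((real k - lam) gchoose k) / (real k + 1)))
    \<and> (\<Sum>k=0..n. (-1) ^ k * fact k * deg_stirling2 lam n k
              * (((real k - lam) gchoose k) / (real k + 1)))
        = deg_bernoulli lam n
    \<and> (\<Sum>k=0..n. deg_stirling1 lam n k * deg_bernoulli lam k)
        = (-1) ^ n * (falling (real n - lam) n / (real n + 1))"
  using deg_B_matrix_0[of lam] deg_bernoulli_eq_sum_deg_stirling2[of lam]
    sum_deg_stirling1_deg_bernoulli[of lam]
  by (simp add: atLeast0AtMost)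

end
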